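(* Let $k\in\mathbb{C}$, $k\neq 0$, and let $\mathfrak{g}_k^{1|1}$ be the complex Lie superalgebra of dimension $1|1$ with even basis element $C$, odd basis element $Z$ and brackets $[C,C]=[C,Z]=0$, $[Z,Z]=-2kC$. Then, up to isomorphism of real Lie superalgebras, $\mathfrak{g}_k^{1|1}$ admits a unique real form $\mathfrak{g}_{k,\mathbb{R}}^{1|1}$ whose even part is $\mathbb{R}\cdot iC$. It is the real Lie superalgebra spanned over $\mathbb{R}$ by $$C'=iC,\qquad Z'=bZ,$$ where $b\in\mathbb{C}^\times$ satisfies $b/\overline{b}=i\,\overline{k}/|k|$, with brackets $$[C',C']=[C',Z']=0,\qquad [Z',Z']=-2|b|^2|k|\,C'.$$
   Context: A real form of a complex Lie superalgebra $\mathfrak{g}$ is the real Lie superalgebra of fixed points of a $\mathbb{C}$-antilinear, involutive, parity-preserving morphism $\rho:\mathfrak{g}\to\mathfrak{g}$ of Lie superalgebras (i.e. $\rho^2=\mathrm{id}$ and $\rho[x,y]=[\rho x,\rho y]$). *)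

theory Defs
  imports Complex_Main "HOL-Library.Z2" "HOL-Library.Product_Plus"
begin

text \<open>
  Super vector spaces are given by an ambient vector space (all of the type) and a family of
  subspaces indexed by the parity in \<open>\<int>/2\<close> (type \<^typ>\<open>bit\<close>); the underlying space is the sum of
  the two subspaces, and need not be the whole ambient space.  In this way a real form sits
  inside the complex algebra.  The bracket is only relevant on the underlying space.
\<close>

record ('k, 'a) superalg =
  scal :: "'k \<Rightarrow> 'a \<Rightarrow> 'a"
  part :: "bit \<Rightarrow> 'a set"
  bracket :: "'a \<Rightarrow> 'a \<Rightarrow> 'a"

definition underlying :: "('k, 'a::ab_group_add) superalg \<Rightarrow> 'a set" where
  "underlying L = {x + y | x y. x \<in> part L 0 \<and> y \<in> part L 1}"

definition koszul_sign :: "bit \<Rightarrow> bit \<Rightarrow> 'k::field" where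
  "koszul_sign i j = (if i * j = 1 then - 1 else 1)"

locale lie_superalgebra =
  fixes L :: "('k::field_char_0, 'a::ab_group_add) superalg"
  assumes vector_space: "vector_space (scal L)"
    and subspace_part: "module.subspace (scal L) (part L i)"
    and direct_sum: "part L 0 \<inter> part L 1 = {0}"
    and bracket_part: "x \<in> part L i \<Longrightarrow> y \<in> part L j \<Longrightarrow> bracket L x y \<in> part L (i + j)"
    and bracket_add_left: "x \<in> underlying L \<Longrightarrow> y \<in> underlying L \<Longrightarrow> z \<in> underlying L \<Longrightarrow>
      bracket L (x + y) z = bracket L x z + bracket L y z"
    and bracket_add_right: "x \<in> underlying L \<Longrightarrow> y \<in> underlying L \<Longrightarrow> z \<in> underlying L \<Longrightarrow>
      bracket L x (y + z) = bracket L x y + bracket L x z"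
    and bracket_scal_left: "x \<in> underlying L \<Longrightarrow> y \<in> underlying L \<Longrightarrow>
      bracket L (scal L c x) y = scal L c (bracket L x y)"
    and bracket_scal_right: "x \<in> underlying L \<Longrightarrow> y \<in> underlying L \<Longrightarrow>
      bracket L x (scal L c y) = scal L c (bracket L x y)"
    and super_skew: "x \<in> part L i \<Longrightarrow> y \<in> part L j \<Longrightarrow>
      bracket L x y = - scal L (koszul_sign i j) (bracket L y x)"
    and super_jacobi: "x \<in> part L i \<Longrightarrow> y \<in> part L j \<Longrightarrow> z \<in> part L l \<Longrightarrow>
      bracket L x (bracket L y z) =
        bracket L (bracket L x y) z + scal L (koszul_sign i j) (bracket L y (bracket L x z))"

definition superalg_iso ::
  "('k, 'a::ab_group_add) superalg \<Rightarrow> ('k, 'b::ab_group_add) superalg \<Rightarrow> ('a \<Rightarrow> 'b) \<Rightarrow> bool" where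
  "superalg_iso L M f \<longleftrightarrow>
    bij_betw f (underlying L) (underlying M) \<and>
    (\<forall>i. f ` part L i = part M i) \<and>
    (\<forall>x\<in>underlying L. \<forall>y\<in>underlying L. f (x + y) = f x + f y) \<and>
    (\<forall>c. \<forall>x\<in>underlying L. f (scal L c x) = scal M c (f x)) \<and>
    (\<forall>x\<in>underlying L. \<forall>y\<in>underlying L. f (bracket L x y) = bracket M (f x) (f y))"

definition superalg_isomorphic ::
  "('k, 'a::ab_group_add) superalg \<Rightarrow> ('k, 'b::ab_group_add) superalg \<Rightarrow> bool" where
  "superalg_isomorphic L M \<longleftrightarrow> (\<exists>f. superalg_iso L M f)"

definition real_scal :: "(complex, 'a) superalg \<Rightarrow> real \<Rightarrow> 'a \<Rightarrow> 'a" where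
  "real_scal L r = scal L (complex_of_real r)"

definition real_line :: "(complex, 'a) superalg \<Rightarrow> 'a \<Rightarrow> 'a set" where
  "real_line L x = {real_scal L r x | r. True}"

definition conjugation :: "(complex, 'a::ab_group_add) superalg \<Rightarrow> ('a \<Rightarrow> 'a) \<Rightarrow> bool" where
  "conjugation L \<rho> \<longleftrightarrow>
    (\<forall>i. \<forall>x\<in>part L i. \<rho> x \<in> part L i) \<and>
    (\<forall>x\<in>underlying L. \<forall>y\<in>underlying L. \<rho> (x + y) = \<rho> x + \<rho> y) \<and>
    (\<forall>c. \<forall>x\<in>underlying L. \<rho> (scal L c x) = scal L (cnj c) (\<rho> x)) \<and>
    (\<forall>x\<in>underlying L. \<rho> (\<rho> x) = x) \<and>
    (\<forall>x\<in>underlying L. \<forall>y\<in>underlying L. \<rho> (bracket L x y) = bracket L (\<rho> x) (\<rho> y))"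

definition fixed_points ::
  "(complex, 'a::ab_group_add) superalg \<Rightarrow> ('a \<Rightarrow> 'a) \<Rightarrow> (real, 'a) superalg" where
  "fixed_points L \<rho> =
    \<lparr>scal = real_scal L, part = (\<lambda>i. {x \<in> part L i. \<rho> x = x}), bracket = bracket L\<rparr>"

definition real_form ::
  "(complex, 'a::ab_group_add) superalg \<Rightarrow> (real, 'a) superalg \<Rightarrow> bool" where
  "real_form L R \<longleftrightarrow> (\<exists>\<rho>. conjugation L \<rho> \<and> R = fixed_points L \<rho>)"

lemma (in lie_superalgebra) part_underlying: "x \<in> part L i \<Longrightarrow> x \<in> underlying L"
proof -
  interpret vector_space "scal L" by (rule vector_space)
  assume x: "x \<in> part L i"
  have "0 \<in> part L 0" "0 \<in> part L 1" using subspace_part subspace_0 by blast+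
  with x show ?thesis unfolding underlying_def
    by (cases i) (force, force)
qed

lemma real_form_lie_superalgebra:
  assumes "lie_superalgebra L" "real_form L R"
  shows "lie_superalgebra R"
proof -
  interpret L: lie_superalgebra L by fact
  interpret V: vector_space "scal L" by (rule L.vector_space)
  obtain \<rho> where rho: "conjugation L \<rho>" and R: "R = fixed_points L \<rho>"
    using assms(2) by (auto simp: real_form_def)
  note c = rho[unfolded conjugation_def]
  have vs: "vector_space (scal R)"
    by unfold_locales (simp_all add: R fixed_points_def real_scal_def algebra_simps)
  interpret W: vector_space "scal R" by (rule vs)
  have U: "underlying R \<subseteq> underlying L"
    by (auto simp: underlying_def R fixed_points_def)
  have br: "bracket R = bracket L" and sc: "scal R r = scal L (complex_of_real r)" for r
    by (simp_all add: R fixed_points_def real_scal_def fun_eq_iff)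
  have pt: "x \<in> part R i \<longleftrightarrow> x \<in> part L i \<and> \<rho> x = x" for x i
    by (auto simp: R fixed_points_def)
  have z: "0 \<in> part L i" for i using L.subspace_part V.subspace_0 by blast
  have rho0: "\<rho> 0 = 0"
    using c[THEN conjunct2, THEN conjunct2, THEN conjunct1, rule_format, of 0 0]
      L.part_underlying[OF z] by simp
  have ks: "complex_of_real (koszul_sign i j) = koszul_sign i j" for i j
    by (simp add: koszul_sign_def)
  show ?thesis
  proof
    show "W.subspace (part R i)" for i
      unfolding W.subspace_def
      using c L.part_underlying z rho0 L.subspace_part[of i, unfolded V.subspace_def]
      by (auto simp: pt sc)
    show "part R 0 \<inter> part R 1 = {0}"
      using L.direct_sum rho0 z by (auto simp: pt)
    show "bracket R x y \<in> part R (i + j)" if "x \<in> part R i" "y \<in> part R j" for x y i j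
      using that c L.part_underlying L.bracket_part by (auto simp: pt br)
    show "bracket R x y = - scal R (koszul_sign i j) (bracket R y x)"
      if "x \<in> part R i" "y \<in> part R j" for x y i j
      using that L.super_skew[of x i y j] by (simp add: pt br sc ks)
    show "bracket R x (bracket R y z) =
        bracket R (bracket R x y) z + scal R (koszul_sign i j) (bracket R y (bracket R x z))"
      if "x \<in> part R i" "y \<in> part R j" "z \<in> part R l" for x y z i j l
      using that L.super_jacobi[of x i y j z l] by (simp add: pt br sc ks)
  qed (use U in \<open>auto simp: br sc subset_iff L.bracket_add_left L.bracket_add_right
      L.bracket_scal_left L.bracket_scal_right vs\<close>)
qed

definition real_span ::
  "(complex, 'a::ab_group_add) superalg \<Rightarrow> 'a \<Rightarrow> 'a \<Rightarrow> (real, 'a) superalg" where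
  "real_span L x y =
    \<lparr>scal = real_scal L,
     part = (\<lambda>i. if i = 0 then module.span (real_scal L) {x} else module.span (real_scal L) {y}),
     bracket = bracket L\<rparr>"

definition is_g11 :: "complex \<Rightarrow> (complex, 'a::ab_group_add) superalg \<Rightarrow> 'a \<Rightarrow> 'a \<Rightarrow> bool" where
  "is_g11 k L C Z \<longleftrightarrow>
    lie_superalgebra L \<and>
    C \<noteq> 0 \<and> part L 0 = module.span (scal L) {C} \<and>
    Z \<noteq> 0 \<and> part L 1 = module.span (scal L) {Z} \<and>
    bracket L C C = 0 \<and> bracket L C Z = 0 \<and>
    bracket L Z Z = scal L (- 2 * k) C"

text \<open>The presentation \<^const>\<open>is_g11\<close> is consistent for every \<open>k\<close>:\<close>

definition g11 :: "complex \<Rightarrow> (complex, complex \<times> complex) superalg" where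
  "g11 k =
    \<lparr>scal = (\<lambda>c x. (c * fst x, c * snd x)),
     part = (\<lambda>i. if i = 0 then {x. snd x = 0} else {x. fst x = 0}),
     bracket = (\<lambda>x y. (- 2 * k * snd x * snd y, 0))\<rparr>"

lemma is_g11_g11: "is_g11 k (g11 k) (1, 0) (0, 1)"
proof -
  have vs: "vector_space (scal (g11 k))"
    by unfold_locales (auto simp: g11_def algebra_simps)
  interpret vector_space "scal (g11 k)" by (rule vs)
  have "lie_superalgebra (g11 k)"
  proof (rule lie_superalgebra.intro)
    show "vector_space (scal (g11 k))" by (rule vs)
    show "subspace (part (g11 k) i)" for i
      by (auto simp: subspace_def) (auto simp: g11_def split: if_splits)
    show "part (g11 k) 0 \<inter> part (g11 k) 1 = {0}"
      by (auto simp: g11_def prod_eq_iff)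
  qed (auto simp: g11_def koszul_sign_def algebra_simps prod_eq_iff split: if_splits)
  moreover have "part (g11 k) 0 = span {(1, 0)}" "part (g11 k) 1 = span {(0, 1)}"
    by (auto simp: span_singleton) (auto simp: g11_def image_iff prod_eq_iff)
  ultimately show ?thesis
    by (simp add: is_g11_def) (simp add: g11_def zero_prod_def)
qed

end

theory Submission imports Defs begin

text \<open>
  A $1|1$-dimensional Lie superalgebra with $[C,C] = [C,Z] = 0$ and $[Z,Z] = lC$, $l \neq 0$, is
  determined by the base field alone, since \<open>l\<close> can be changed arbitrarily by rescaling \<open>C\<close>.  A
  conjugation acts on \<open>Z\<close> by some \<open>a\<close> with $|a| = 1$, and writing $a = b/\overline{b}$ its odd fixed
  points are $\mathbb{R}\cdot bZ$; so each real form with even part $\mathbb{R}\cdot iC$ is of this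
  kind over $\mathbb{R}$.
\<close>

section \<open>Coordinates in dimension 1|1 over any field of characteristic 0, to serve over
  \<complex> and \<real> alike\<close>

locale lie_superalgebra_11 = lie_superalgebra L
  for L :: "('k::field_char_0, 'a::ab_group_add) superalg" +
  fixes C Z :: 'a and l :: 'k
  assumes C_nz: "C \<noteq> 0" and Z_nz: "Z \<noteq> 0"
    and part_0: "part L 0 = range (\<lambda>c. scal L c C)"
    and part_1: "part L 1 = range (\<lambda>c. scal L c Z)"
    and bracket_CC: "bracket L C C = 0"
    and bracket_CZ: "bracket L C Z = 0"
    and bracket_ZZ: "bracket L Z Z = scal L l C"
begin

sublocale V: vector_space "scal L"
  by (rule vector_space)

lemma C_part: "scal L c C \<in> part L 0" and Z_part: "scal L c Z \<in> part L 1"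
  by (auto simp: part_0 part_1)

lemma underlying_eq: "underlying L = {scal L a C + scal L b Z | a b. True}"
  unfolding underlying_def part_0 part_1 by blast

lemma mem_underlying: "scal L a C + scal L b Z \<in> underlying L"
  unfolding underlying_eq by blast

lemma underlyingE:
  assumes "v \<in> underlying L"
  obtains a b where "v = scal L a C + scal L b Z"
  using assms unfolding underlying_eq by blast

text \<open>The difference of two expansions puts a multiple of \<open>C\<close> into both the even
  and the odd part, which meet only in 0.\<close>

lemma coordinates_eq_iff:
  "scal L a C + scal L b Z = scal L a' C + scal L b' Z \<longleftrightarrow> a = a' \<and> b = b'"
proof
  assume "scal L a C + scal L b Z = scal L a' C + scal L b' Z"
  then have eq: "scal L (a - a') C = scal L (b' - b) Z"
    by (simp add: V.scale_left_diff_distrib algebra_simps)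
  then have "scal L (a - a') C \<in> part L 0 \<inter> part L 1"
    using C_part Z_part by (metis IntI)
  then have "scal L (a - a') C = 0"
    using direct_sum by blast
  with eq show "a = a' \<and> b = b'"
    using C_nz Z_nz by auto
qed simp

lemma add_coordinates:
  "scal L a C + scal L b Z + (scal L a' C + scal L b' Z) = scal L (a + a') C + scal L (b + b') Z"
  by (simp add: V.scale_left_distrib algebra_simps)

lemma scal_coordinates:
  "scal L c (scal L a C + scal L b Z) = scal L (c * a) C + scal L (c * b) Z"
  by (simp add: V.scale_right_distrib)

text \<open>Isomorphisms and conjugations will be specified by formulas in the coordinates;
  uniqueness of the coordinates makes such a formula well defined.\<close>

lemma coordinate_map:
  obtains f where "\<And>a b. f (scal L a C + scal L b Z) = g a b"
proof
  fix a b
  show "(\<lambda>v. g (THE a. \<exists>b. v = scal L a C + scal L b Z) (THE b. \<exists>a. v = scal L a C + scal L b Z))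
      (scal L a C + scal L b Z) = g a b"
    by (simp add: coordinates_eq_iff)
qed

lemma bracket_ZC: "bracket L Z C = 0"
  using super_skew[of Z 1 C 0] C_part[of 1] Z_part[of 1] by (simp add: bracket_CZ)

text \<open>Bilinear expansion leaves only the term with [Z,Z], since every other bracket of basis
  elements vanishes.\<close>

lemma bracket_eq:
  "bracket L (scal L a C + scal L b Z) (scal L a' C + scal L b' Z) = scal L (b * b' * l) C"
proof -
  have u: "scal L c C \<in> underlying L" "scal L c Z \<in> underlying L"
    "C \<in> underlying L" "Z \<in> underlying L" for c
    using part_underlying[OF C_part] part_underlying[OF Z_part]
      part_underlying[OF C_part[of 1]] part_underlying[OF Z_part[of 1]] by simp_all
  show ?thesis
    by (simp add: bracket_add_left bracket_add_right u mem_underlying bracket_scal_left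
        bracket_scal_right bracket_CC bracket_CZ bracket_ZC bracket_ZZ mult_ac)
qed

end

section \<open>Isomorphisms between algebras of dimension 1|1\<close>

lemma is_g11_lie_superalgebra_11:
  assumes "is_g11 k L C Z"
  shows "lie_superalgebra_11 L C Z (- 2 * k)"
proof -
  interpret lie_superalgebra L
    using assms by (simp add: is_g11_def)
  interpret vector_space "scal L"
    by (rule vector_space)
  show ?thesis
    using assms by unfold_locales (simp_all add: is_g11_def span_singleton)
qed

text \<open>Sending \<open>Z\<close> to \<open>W\<close> forces the image of \<open>C\<close>: from
  [Z,Z] = lC and [W,W] = mD it must be (m/l)D, and this choice respects all brackets.\<close>

lemma superalg_isomorphic_11:
  assumes "lie_superalgebra_11 L C Z l" "lie_superalgebra_11 M D W m" "l \<noteq> 0" "m \<noteq> 0"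
  shows "superalg_isomorphic L M"
proof -
  interpret L: lie_superalgebra_11 L C Z l by fact
  interpret M: lie_superalgebra_11 M D W m by fact
  define t where "t = m / l"
  have t: "t \<noteq> 0" "l * t = m"
    using assms(3,4) by (auto simp: t_def)
  obtain f where f: "\<And>a b. f (scal L a C + scal L b Z) = scal M (a * t) D + scal M b W"
    using L.coordinate_map[of "\<lambda>a b. scal M (a * t) D + scal M b W"] by blast
  have f0: "f (scal L a C) = scal M (a * t) D" for a
    using f[of a 0] by simp
  have f1: "f (scal L b Z) = scal M b W" for b
    using f[of 0 b] by simp
  have surj_t: "range (\<lambda>a. scal M (a * t) D) = range (\<lambda>a. scal M a D)"
    using t(1) by (auto simp: image_iff) (metis nonzero_eq_divide_eq)
  have "bij_betw f (underlying L) (underlying M)"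
  proof (rule bij_betw_imageI)
    show "inj_on f (underlying L)"
      using t(1) by (auto simp: inj_on_def f M.coordinates_eq_iff elim!: L.underlyingE)
    \<comment> \<open>Dividing the even coordinate by \<open>t\<close> exhibits a preimage.\<close>
    have "f (scal L (a / t) C + scal L b Z) = scal M a D + scal M b W" for a b
      using t(1) by (simp add: f)
    then have "scal M a D + scal M b W \<in> f ` underlying L" for a b
      by (metis L.mem_underlying imageI)
    moreover have "f ` underlying L \<subseteq> underlying M"
      by (auto simp: f M.mem_underlying elim!: L.underlyingE)
    ultimately show "f ` underlying L = underlying M"
      by (auto elim!: M.underlyingE)
  qed
  moreover have "f ` part L i = part M i" for i
    by (cases i) (simp_all add: L.part_0 L.part_1 M.part_0 M.part_1 image_image f0 f1 surj_t)
  moreover have "f (x + y) = f x + f y" if "x \<in> underlying L" "y \<in> underlying L" for x y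
    using that by (auto simp: f L.add_coordinates M.add_coordinates distrib_right elim!: L.underlyingE)
  moreover have "f (scal L c x) = scal M c (f x)" if "x \<in> underlying L" for c x
    using that by (auto simp: f L.scal_coordinates M.scal_coordinates mult_ac elim!: L.underlyingE)
  moreover have "f (bracket L x y) = bracket M (f x) (f y)"
    if "x \<in> underlying L" "y \<in> underlying L" for x y
    using that t(2) by (auto simp: f f0 L.bracket_eq M.bracket_eq mult_ac elim!: L.underlyingE)
  ultimately have "superalg_iso L M f"
    unfolding superalg_iso_def by (intro conjI allI ballI)
  then show ?thesis
    unfolding superalg_isomorphic_def by blast
qed

section \<open>Complex numbers of modulus 1 and the real lines fixed by antilinear maps\<close>

text \<open>A square root b of a also has modulus 1, so its inverse is its conjugate and b / cnj b =
  b^2 = a.\<close>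

lemma unit_eq_div_cnj:
  assumes "cmod a = 1"
  obtains b where "b \<noteq> 0" "b / cnj b = a"
proof
  have n: "cmod (csqrt a) = 1"
    using assms by simp
  then show nz: "csqrt a \<noteq> 0"
    by (metis norm_zero zero_neq_one)
  have "csqrt a * cnj (csqrt a) = 1"
    using n by (simp add: complex_norm_square[symmetric])
  then have "csqrt a / cnj (csqrt a) = (csqrt a)\<^sup>2"
    using nz by (simp add: field_simps power2_eq_square)
  then show "csqrt a / cnj (csqrt a) = a"
    by simp
qed

text \<open>Dividing by \<open>b\<close> turns the equation into cnj (y / b) = y / b, that is, y / b
  is real.\<close>

lemma cnj_mult_div_cnj_eq_iff:
  assumes "b \<noteq> 0"
  shows "cnj y * (b / cnj b) = y \<longleftrightarrow> (\<exists>r. y = complex_of_real r * b)"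
proof
  assume y: "cnj y * (b / cnj b) = y"
  then have "cnj (y / b) = y / b"
    using assms by (simp add: field_simps)
  then have "y / b \<in> \<real>"
    by (simp add: Reals_cnj_iff)
  then show "\<exists>r. y = complex_of_real r * b"
    using assms by (auto elim!: Reals_cases simp: field_simps)
qed (use assms in \<open>auto simp: field_simps\<close>)

lemma real_span_singleton:
  assumes "vector_space (scal L)"
  shows "module.span (real_scal L) {x} = real_line L x"
proof -
  interpret V: vector_space "scal L" by fact
  interpret vector_space "real_scal L"
    by unfold_locales (simp_all add: real_scal_def algebra_simps)
  show ?thesis
    by (auto simp: span_singleton real_line_def)
qed

section \<open>Shape and uniqueness of the real forms with even part \<real> iC\<close>

lemma real_form_lie_superalgebra_11:
  assumes L: "lie_superalgebra_11 L C Z l" and "l \<noteq> 0"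
    and R: "real_form L R" "part R 0 = real_line L (scal L \<i> C)"
  obtains b r where "lie_superalgebra_11 R (scal L \<i> C) (scal L b Z) r" "r \<noteq> 0"
proof -
  interpret L: lie_superalgebra_11 L C Z l by fact
  interpret R: lie_superalgebra R
    using real_form_lie_superalgebra[OF L.lie_superalgebra_axioms R(1)] .
  obtain \<rho> where rho: "conjugation L \<rho>" and Req: "R = fixed_points L \<rho>"
    using R(1) by (auto simp: real_form_def)
  note c = rho[unfolded conjugation_def]
  have scR: "scal R r x = scal L (complex_of_real r) x" for r x
    by (simp add: Req fixed_points_def real_scal_def)
  have brR: "bracket R = bracket L"
    by (simp add: Req fixed_points_def)
  have Z1: "Z \<in> part L 1"
    using L.Z_part[of 1] by simp
  then have "\<rho> Z \<in> part L 1"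
    using c by blast
  then obtain a where a: "\<rho> Z = scal L a Z"
    by (auto simp: L.part_1)
  have rho_scal: "\<rho> (scal L y Z) = scal L (cnj y * a) Z" for y
    using c L.part_underlying[OF Z1] by (simp add: a)
  have "\<rho> (\<rho> Z) = Z"
    using c L.part_underlying[OF Z1] by blast
  \<comment> \<open>By antilinearity the second application of \<open>\<rho>\<close> conjugates the
    first factor \<open>a\<close>, so being an involution forces |a| = 1.\<close>
  then have "scal L (cnj a * a) Z = scal L 1 Z"
    by (simp add: a rho_scal)
  then have "cnj a * a = 1"
    using L.Z_nz by (simp only: L.V.scale_cancel_right simp_thms)
  then have "cmod a = 1"
    using complex_mod_mult_cnj[of a] abs_square_eq_1[of "cmod a"] by (simp add: mult.commute)
  then obtain b where b: "b \<noteq> 0" "b / cnj b = a"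
    by (rule unit_eq_div_cnj)
  \<comment> \<open>A vector yZ is fixed exactly when cnj y * a = y; since a = b / cnj b, the
    solutions are the real multiples of \<open>b\<close>.\<close>
  have part1: "part R 1 = range (\<lambda>r. scal R r (scal L b Z))"
  proof -
    have "part R 1 = {scal L y Z | y. cnj y * a = y}"
      using L.Z_nz by (auto simp: Req fixed_points_def L.part_1 rho_scal)
    then show ?thesis
      using cnj_mult_div_cnj_eq_iff[OF b(1)] b(2) by (auto simp: scR)
  qed
  have part0: "part R 0 = range (\<lambda>r. scal R r (scal L \<i> C))"
    using R(2) by (auto simp: scR real_line_def real_scal_def)
  have br: "bracket R (scal L b Z) (scal L b Z) = scal L (b * b * l) C"
    using L.bracket_eq[of 0 b 0 b] by (simp add: brR)
  have bZ: "scal L b Z \<in> part R 1"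
    unfolding part1 by (rule range_eqI[of _ _ 1]) (simp add: scR)
  \<comment> \<open>Closure of \<open>R\<close> under the bracket, together with the given even
    part, makes b^2 l a real multiple of i; this real factor is the structure constant
    \<open>r\<close>.\<close>
  have "bracket R (scal L b Z) (scal L b Z) \<in> part R 0"
    using R.bracket_part[OF bZ bZ] by simp
  then obtain r where r: "bracket R (scal L b Z) (scal L b Z) = scal R r (scal L \<i> C)"
    by (auto simp: part0)
  \<comment> \<open>The bracket is also b^2 l C, with b, l and C all nonzero.\<close>
  have "r \<noteq> 0"
    using r br b(1) \<open>l \<noteq> 0\<close> L.C_nz by (auto simp: scR)
  moreover have "lie_superalgebra_11 R (scal L \<i> C) (scal L b Z) r"
    using part0 part1 r L.bracket_eq[of \<i> 0 \<i> 0] L.bracket_eq[of \<i> 0 0 b] L.C_nz L.Z_nz b(1)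
    by unfold_locales (simp_all add: brR)
  ultimately show ?thesis
    using that by blast
qed

lemma isomorphic_real_forms:
  assumes "lie_superalgebra_11 L C Z l" "l \<noteq> 0"
    and "real_form L R" "part R 0 = real_line L (scal L \<i> C)"
    and "real_form L S" "part S 0 = real_line L (scal L \<i> C)"
  shows "superalg_isomorphic R S"
proof -
  obtain b r where "lie_superalgebra_11 R (scal L \<i> C) (scal L b Z) r" "r \<noteq> 0"
    using real_form_lie_superalgebra_11[OF assms(1-4)] .
  moreover obtain b' s where "lie_superalgebra_11 S (scal L \<i> C) (scal L b' Z) s" "s \<noteq> 0"
    using real_form_lie_superalgebra_11[OF assms(1,2,5,6)] .
  ultimately show ?thesis
    by (metis superalg_isomorphic_11)
qed

section \<open>Construction of a real form from a suitable b\<close>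

text \<open>The condition on \<open>l\<close> is what a conjugation with C \<mapsto> -C and Z
  \<mapsto> aZ, a = b / cnj b, must satisfy: applied to [Z,Z] = lC it gives a^2 l C on one side and
  -(cnj l) C on the other.\<close>

lemma real_form_real_span:
  assumes L: "lie_superalgebra_11 L C Z l" and "b \<noteq> 0"
    and l: "(b / cnj b)\<^sup>2 * l = - cnj l"
  shows "real_form L (real_span L (scal L \<i> C) (scal L b Z))"
proof -
  interpret L: lie_superalgebra_11 L C Z l by fact
  define a where "a = b / cnj b"
  \<comment> \<open>This is the antilinear map that fixes both iC and bZ.\<close>
  obtain \<rho> where rho: "\<And>x y. \<rho> (scal L x C + scal L y Z) = scal L (- cnj x) C + scal L (cnj y * a) Z"
    using L.coordinate_map[of "\<lambda>x y. scal L (- cnj x) C + scal L (cnj y * a) Z"] by blast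
  have rho0: "\<rho> (scal L x C) = scal L (- cnj x) C" for x
    using rho[of x 0] by simp
  have rho1: "\<rho> (scal L y Z) = scal L (cnj y * a) Z" for y
    using rho[of 0 y] by simp
  have aa: "cnj a * a = 1"
    using \<open>b \<noteq> 0\<close> by (simp add: a_def)
  have la: "cnj l = - (a * a * l)"
    using l by (simp add: a_def power2_eq_square)
  have "conjugation L \<rho>"
    unfolding conjugation_def
  proof (intro conjI allI ballI)
    show "\<rho> x \<in> part L i" if "x \<in> part L i" for x i
      using that by (cases i) (auto simp: L.part_0 L.part_1 rho0 rho1 simp del: L.V.scale_minus_left)
    show "\<rho> (x + y) = \<rho> x + \<rho> y" if "x \<in> underlying L" "y \<in> underlying L" for x y
      using that by (auto simp: rho L.add_coordinates L.coordinates_eq_iff distrib_right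
          simp del: L.V.scale_minus_left elim!: L.underlyingE)
    show "\<rho> (scal L c x) = scal L (cnj c) (\<rho> x)" if "x \<in> underlying L" for c x
      using that by (auto simp: rho L.scal_coordinates L.coordinates_eq_iff
          simp del: L.V.scale_minus_left elim!: L.underlyingE)
    show "\<rho> (\<rho> x) = x" if "x \<in> underlying L" for x
      using that aa by (auto simp: rho L.coordinates_eq_iff
          simp del: L.V.scale_minus_left elim!: L.underlyingE)
    show "\<rho> (bracket L x y) = bracket L (\<rho> x) (\<rho> y)"
      if "x \<in> underlying L" "y \<in> underlying L" for x y
      using that by (auto simp: rho rho0 L.bracket_eq la mult_ac
          simp del: L.V.scale_minus_left elim!: L.underlyingE)
  qed
  \<comment> \<open>Scalars and bracket of the two records agree by definition, so only the
    homogeneous parts have to be compared.\<close>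
  moreover have "part (fixed_points L \<rho>) i = part (real_span L (scal L \<i> C) (scal L b Z)) i" for i
  proof -
    have "{v \<in> part L 0. \<rho> v = v} = {scal L x C | x. - cnj x = x}"
      using L.C_nz by (auto simp: L.part_0 rho0 simp del: L.V.scale_minus_left)
    \<comment> \<open>The even part is the case b = i of the fixed line, because i / cnj i =
      -1.\<close>
    also have "\<dots> = real_line L (scal L \<i> C)"
      using cnj_mult_div_cnj_eq_iff[of \<i>] by (auto simp: real_line_def real_scal_def)
    finally have 0: "{v \<in> part L 0. \<rho> v = v} = real_line L (scal L \<i> C)" .
    have "{v \<in> part L 1. \<rho> v = v} = {scal L y Z | y. cnj y * a = y}"
      using L.Z_nz by (auto simp: L.part_1 rho1)
    also have "\<dots> = real_line L (scal L b Z)"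
      using cnj_mult_div_cnj_eq_iff[OF \<open>b \<noteq> 0\<close>] by (auto simp: a_def real_line_def real_scal_def)
    finally have 1: "{v \<in> part L 1. \<rho> v = v} = real_line L (scal L b Z)" .
    show ?thesis
      using 0 1 by (cases i)
        (simp_all add: fixed_points_def real_span_def real_span_singleton[OF L.vector_space])
  qed
  ultimately show ?thesis
    unfolding real_form_def
    by (intro exI[of _ \<rho>]) (simp add: fixed_points_def real_span_def fun_eq_iff)
qed

section \<open>The case l = -2k with the prescribed value of b / cnj b\<close>

theorem proposition4p4:
  fixes k :: complex
    and L :: "(complex, 'a::ab_group_add) superalg"
    and C Z :: 'a
  assumes "k \<noteq> 0"
    and "is_g11 k L C Z"
  shows "(\<exists>R. real_form L R \<and> part R 0 = real_line L (scal L \<i> C))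
    \<and> (\<forall>R S. real_form L R \<and> part R 0 = real_line L (scal L \<i> C) \<and> real_form L S \<and> part S 0 = real_line L (scal L \<i> C)
          \<longrightarrow> superalg_isomorphic R S)
    \<and> (\<exists>b. b \<noteq> 0 \<and> b / cnj b = \<i> * cnj k / complex_of_real (cmod k))
    \<and> (\<forall>b. b \<noteq> 0 \<and> b / cnj b = \<i> * cnj k / complex_of_real (cmod k) \<longrightarrow>
         (let C' = scal L \<i> C; Z' = scal L b Z; G = real_span L C' Z' in
            lie_superalgebra G \<and> real_form L G \<and> part G 0 = real_line L (scal L \<i> C) \<and>
            bracket G C' C' = 0 \<and> bracket G C' Z' = 0 \<and>
            bracket G Z' Z' = scal G (- 2 * (cmod b)\<^sup>2 * cmod k) C' \<and>
            (\<forall>R. real_form L R \<and> part R 0 = real_line L (scal L \<i> C) \<longrightarrow> superalg_isomorphic R G)))"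
proof -
  interpret L: lie_superalgebra_11 L C Z "- 2 * k"
    by (rule is_g11_lie_superalgebra_11) fact
  have L11: "lie_superalgebra_11 L C Z (- 2 * k)"
    by unfold_locales
  have iso: "superalg_isomorphic R S"
    if "real_form L R" "part R 0 = real_line L (scal L \<i> C)"
      "real_form L S" "part S 0 = real_line L (scal L \<i> C)" for R S
    using isomorphic_real_forms[OF L11 _ that] \<open>k \<noteq> 0\<close> by simp
  \<comment> \<open>Modulus 1 is what makes the prescribed quotient attainable by some b.\<close>
  have "cmod (\<i> * cnj k / complex_of_real (cmod k)) = 1"
    using \<open>k \<noteq> 0\<close> by (simp add: norm_divide norm_mult)
  then obtain b0 where b0: "b0 \<noteq> 0" "b0 / cnj b0 = \<i> * cnj k / complex_of_real (cmod k)"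
    by (rule unit_eq_div_cnj)
  let ?G = "\<lambda>b. real_span L (scal L \<i> C) (scal L b Z)"
  have part_G: "part (?G b) 0 = real_line L (scal L \<i> C)" for b
    by (simp add: real_span_def real_span_singleton[OF L.vector_space])
  have kk: "k * cnj k = (complex_of_real (cmod k))\<^sup>2"
    using complex_norm_square[of k] by simp
  have G: "real_form L (?G b)"
    if "b \<noteq> 0" "b / cnj b = \<i> * cnj k / complex_of_real (cmod k)" for b
  proof (rule real_form_real_span[OF L11 \<open>b \<noteq> 0\<close>])
    \<comment> \<open>The square of i contributes the sign and k * cnj k cancels |k|^2. This is the
      compatibility condition for \<open>k\<close>; it passes to -2k because -2 is real.\<close>
    have "(b / cnj b)\<^sup>2 * k = - (cnj k * (k * cnj k)) / (complex_of_real (cmod k))\<^sup>2"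
      unfolding that(2) power_divide power_mult_distrib by (simp add: power2_eq_square)
    also have "\<dots> = - cnj k"
      using \<open>k \<noteq> 0\<close> by (simp add: kk)
    finally have bk: "(b / cnj b)\<^sup>2 * k = - cnj k" .
    show "(b / cnj b)\<^sup>2 * (- 2 * k) = - cnj (- 2 * k)"
      unfolding mult.left_commute[of _ "- 2"] bk by simp
  qed
  have bracket_G: "bracket (?G b) (scal L b Z) (scal L b Z)
      = scal (?G b) (- 2 * (cmod b)\<^sup>2 * cmod k) (scal L \<i> C)"
    if "b \<noteq> 0" "b / cnj b = \<i> * cnj k / complex_of_real (cmod k)" for b
  proof -
    \<comment> \<open>Splitting b^2 into |b|^2 and b / cnj b brings in the prescribed quotient,
      whose factor i turns C into iC and leaves a real coefficient.\<close>
    have "b * b * k = (b * cnj b) * (b / cnj b) * k"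
      using \<open>b \<noteq> 0\<close> by simp
    also have "\<dots> = (complex_of_real (cmod b))\<^sup>2 * \<i> * (k * cnj k) / complex_of_real (cmod k)"
      unfolding that(2) complex_norm_square[of b, symmetric] by (simp add: mult_ac)
    also have "\<dots> = (complex_of_real (cmod b))\<^sup>2 * complex_of_real (cmod k) * \<i>"
      unfolding kk by (simp add: power2_eq_square)
    finally have bk: "b * b * k
        = (complex_of_real (cmod b))\<^sup>2 * complex_of_real (cmod k) * \<i>" .
    have "b * b * (- 2 * k) = complex_of_real (- 2 * (cmod b)\<^sup>2 * cmod k) * \<i>"
      unfolding mult.left_commute[of _ "- 2"] bk by simp
    then show ?thesis
      using L.bracket_eq[of 0 b 0 b] by (simp add: real_span_def real_scal_def)
  qed
  show ?thesis
    unfolding Let_def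
  proof (intro conjI allI impI; (elim conjE)?)
    show "\<exists>R. real_form L R \<and> part R 0 = real_line L (scal L \<i> C)"
      using G[OF b0] part_G by blast
    show "\<exists>b. b \<noteq> 0 \<and> b / cnj b = \<i> * cnj k / complex_of_real (cmod k)"
      using b0 by blast
    show "superalg_isomorphic R S"
      if "real_form L R" "part R 0 = real_line L (scal L \<i> C)"
        "real_form L S" "part S 0 = real_line L (scal L \<i> C)" for R S
      using iso that .
    fix b
    assume b: "b \<noteq> 0" "b / cnj b = \<i> * cnj k / complex_of_real (cmod k)"
    show "lie_superalgebra (?G b)"
      by (rule real_form_lie_superalgebra[OF L.lie_superalgebra_axioms G[OF b]])
    show "real_form L (?G b)"
      by (rule G[OF b])
    show "part (?G b) 0 = real_line L (scal L \<i> C)"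
      by (rule part_G)
    show "bracket (?G b) (scal L \<i> C) (scal L \<i> C) = 0"
      using L.bracket_eq[of \<i> 0 \<i> 0] by (simp add: real_span_def)
    show "bracket (?G b) (scal L \<i> C) (scal L b Z) = 0"
      using L.bracket_eq[of \<i> 0 0 b] by (simp add: real_span_def)
    show "bracket (?G b) (scal L b Z) (scal L b Z)
        = scal (?G b) (- 2 * (cmod b)\<^sup>2 * cmod k) (scal L \<i> C)"
      by (rule bracket_G[OF b])
    show "superalg_isomorphic R (?G b)"
      if "real_form L R" "part R 0 = real_line L (scal L \<i> C)" for R
      using iso[OF that G[OF b] part_G] .
  qed
qed

end
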